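(* For every $w\in S_\infty$ and every strict partition $\mu$, we have $\kappa^{\mathsf P}_{w,\mu}=\sum_{v\le w}\overline\kappa^{\mathsf P}_{v,\mu}$ and $\kappa^{\mathsf Q}_{w,\mu}=\sum_{v\le w}\overline\kappa^{\mathsf Q}_{v,\mu}$, where $\le$ is the (strong) Bruhat order on $S_\infty$.
   Context: Let $\mathbb P=\{1,2,3,\dots\}$. $S_\infty$ is the group of permutations of $\mathbb P$ generated by $s_i=(i\;\,i+1)$; it acts on $\mathbb Z[x_1,x_2,\dots]$ by permuting variables. Define $\pi_i f=(x_if-x_{i+1}s_if)/(x_i-x_{i+1})$ and $\overline\pi_i=\pi_i-1$. These satisfy the braid relations, so $\pi_w=\pi_{i_1}\cdots\pi_{i_l}$ and $\overline\pi_w=\overline\pi_{i_1}\cdots\overline\pi_{i_l}$ are well-defined for any reduced word $i_1\cdots i_l$ of $w\in S_\infty$. A partition is strict if its nonzero parts are distinct; $\mathsf D_\mu=\{(i,j)\in\mathbb P\times\mathbb P:1\le j\le\mu_i\}$. For $w\in S_\infty$ and a strict partition $\mu$: $$\kappa^{\mathsf P}_{w,\mu}=\pi_w\Big(\prod_{(i,j)\in\mathsf D_\mu}(x_i+x_{i+j})\Big),\quad \kappa^{\mathsf Q}_{w,\mu}=\pi_w\Big(\prod_{(i,j)\in\mathsf D_\mu}(x_i+x_{i+j-1})\Big),$$ $$\overline\kappa^{\mathsf P}_{w,\mu}=\overline\pi_w\Big(\prod_{(i,j)\in\mathsf D_\mu}(x_i+x_{i+j})\Big),\quad \overline\kappa^{\mathsf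 Q}_{w,\mu}=\overline\pi_w\Big(\prod_{(i,j)\in\mathsf D_\mu}(x_i+x_{i+j-1})\Big).$$ *)

theory Defs
  imports "HOL-Library.Poly_Mapping" "HOL-Combinatorics.Transposition"
begin

section \<open>The polynomial ring and the action of permutations\<close>

text \<open>
  A polynomial maps exponent vectors to integer coefficients. Indices live in \<open>nat\<close>, and only the
  positive ones are used: the variable \<open>x\<^sub>0\<close> exists in the type, but it is fixed by every
  permutation below and occurs in none of the polynomials considered, so that everything takes place
  in the subring generated by \<open>x\<^sub>1, x\<^sub>2, \<dots>\<close>.
\<close>

type_synonym ipoly = "(nat \<Rightarrow>\<^sub>0 nat) \<Rightarrow>\<^sub>0 int"

definition X :: "nat \<Rightarrow> ipoly" where
  "X i = Poly_Mapping.single (Poly_Mapping.single i 1) 1"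

text \<open>
  For a bijection \<open>w\<close>, the coefficient of \<open>m\<close> in \<open>act w f\<close> is the coefficient of
  \<open>m \<circ> w\<close> in \<open>f\<close>; that is, \<open>x\<^sub>i\<close> is replaced by \<open>x\<^bsub>w(i)\<^esub>\<close>.
\<close>

definition act :: "(nat \<Rightarrow> nat) \<Rightarrow> ipoly \<Rightarrow> ipoly" where
  "act w f = Poly_Mapping.map_key (Poly_Mapping.map_key w) f"

abbreviation adj :: "nat \<Rightarrow> nat \<Rightarrow> nat" where
  "adj i \<equiv> transpose i (Suc i)"

lemma inj_map_key:
  assumes "bij w"
  shows "inj (Poly_Mapping.map_key w :: ('a \<Rightarrow>\<^sub>0 'c::zero) \<Rightarrow> ('b \<Rightarrow>\<^sub>0 'c))"
proof (rule injI)
  fix m n :: "'a \<Rightarrow>\<^sub>0 'c"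
  assume eq: "Poly_Mapping.map_key w m = Poly_Mapping.map_key w n"
  show "m = n"
  proof (rule poly_mapping_eqI)
    fix k
    obtain j where "k = w j" using assms by (metis bij_pointE)
    with arg_cong[OF eq, of "\<lambda>p. Poly_Mapping.lookup p j"] assms
    show "Poly_Mapping.lookup m k = Poly_Mapping.lookup n k"
      by (simp add: map_key.rep_eq bij_is_inj)
  qed
qed

lemma map_key_inv:
  assumes "bij w"
  shows "Poly_Mapping.map_key w (Poly_Mapping.map_key (inv w) m) = m"
  using assms
  by (simp add: map_key_compose bij_is_inj bij_is_surj bij_imp_bij_inv map_key_id[unfolded id_def[symmetric]])

lemma act_single:
  assumes "bij w"
  shows "act w (Poly_Mapping.single m c) = Poly_Mapping.single (Poly_Mapping.map_key (inv w) m) c"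
  unfolding act_def
  using map_key_single[OF inj_map_key[OF assms], of "Poly_Mapping.map_key (inv w) m" c]
  by (simp add: map_key_inv assms)

lemma act_X:
  assumes "bij w"
  shows "act w (X i) = X (w i)"
  using assms map_key_single[of "inv w" "w i" "1::nat"]
  by (simp add: X_def act_single bij_imp_bij_inv bij_is_inj)

lemma act_add: "bij w \<Longrightarrow> act w (f + g) = act w f + act w g"
  by (simp add: act_def map_key_plus inj_map_key)

lemma act_diff: "bij w \<Longrightarrow> act w (f - g) = act w f - act w g"
  using act_add[of w "f - g" g] by (simp add: algebra_simps)

lemma act_zero: "bij w \<Longrightarrow> act w 0 = 0"
  by (simp add: act_def inj_map_key)

lemma act_mult:
  assumes "bij w"
  shows "act w (f * g) = act w f * act w g"
proof (induction f rule: frag_induction[OF subset_UNIV])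
  case (2 m)
  show ?case
    by (induction g rule: frag_induction[OF subset_UNIV])
      (simp_all add: assms act_zero act_single mult_single map_key_plus bij_imp_bij_inv bij_is_inj
        act_diff right_diff_distrib)
qed (simp_all add: assms act_zero act_diff left_diff_distrib)

section \<open>Isobaric divided differences\<close>

text \<open>The quotient of \<open>x\<^sub>i f - x\<^bsub>i+1\<^esub> s\<^sub>i f\<close> by \<open>x\<^sub>i - x\<^bsub>i+1\<^esub>\<close>, cf. lemma \<open>pi_op_mult\<close>.\<close>

definition pi_op :: "nat \<Rightarrow> ipoly \<Rightarrow> ipoly" where
  "pi_op i f = (THE g. (X i - X (Suc i)) * g = X i * f - X (Suc i) * act (adj i) f)"

definition pi_bar_op :: "nat \<Rightarrow> ipoly \<Rightarrow> ipoly" where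
  "pi_bar_op i f = pi_op i f - f"

lemma X_diff_nonzero: "X i - X (Suc i) \<noteq> 0"
proof
  assume "X i - X (Suc i) = 0"
  then have "X i = X (Suc i)" by simp
  then have "Poly_Mapping.keys (X i) = Poly_Mapping.keys (X (Suc i))" by simp
  then have "Poly_Mapping.keys (Poly_Mapping.single i (1::nat)) = Poly_Mapping.keys (Poly_Mapping.single (Suc i) (1::nat))"
    by (simp add: X_def)
  then show False by simp
qed

lemma X_power: "X k ^ v = Poly_Mapping.single (Poly_Mapping.single k v) 1"
  by (induction v) (simp_all add: X_def mult_single single_add[symmetric])

lemma diff_dvd_act:
  "X i - X (Suc i) dvd f - act (adj i) f"
proof -
  let ?d = "X i - X (Suc i)"
  have b: "bij (adj i)" by simp
  have mult: "?d dvd f * g - act (adj i) (f * g)"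
    if "?d dvd f - act (adj i) f" "?d dvd g - act (adj i) g" for f g
  proof -
    have "f * g - act (adj i) (f * g) = f * (g - act (adj i) g) + (f - act (adj i) f) * act (adj i) g"
      by (simp add: act_mult b algebra_simps)
    then show ?thesis using that by simp
  qed
  have one: "act (adj i) 1 = 1"
    using act_single[OF b, of 0 1] by (simp add: bij_imp_bij_inv bij_is_inj)
  have var: "?d dvd X k - act (adj i) (X k)" for k
  proof -
    consider "k = i" | "k = Suc i" | "k \<noteq> i" "k \<noteq> Suc i" by blast
    then show ?thesis
    proof cases
      case 2
      then have "X k - act (adj i) (X k) = - ?d" by (simp add: act_X)
      then show ?thesis by (metis dvd_minus_iff dvd_refl)
    qed (simp_all add: act_X)
  qed
  have pow: "?d dvd X k ^ v - act (adj i) (X k ^ v)" for k v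
    by (induction v) (simp_all add: one mult var)
  have mono: "?d dvd frag_of m - act (adj i) (frag_of m)" for m
  proof (induction m rule: update_induct)
    case const
    show ?case by (simp add: one)
  next
    case (update m k v)
    have "Poly_Mapping.update k v m = Poly_Mapping.single k v + m"
      using update(1)
      by (intro poly_mapping_eqI)
        (auto simp: lookup_update lookup_add lookup_single in_keys_iff when_def)
    then have "frag_of (Poly_Mapping.update k v m) = X k ^ v * frag_of m"
      by (simp add: X_power mult_single)
    then show ?case using mult[OF pow update(3)] by simp
  qed
  show ?thesis
  proof (induction f rule: frag_induction[OF subset_UNIV])
    case 1
    show ?case by (simp add: act_zero)
  next
    case (2 m)
    show ?case by (rule mono)
  next
    case (3 f g)
    have "f - g - act (adj i) (f - g) = (f - act (adj i) f) - (g - act (adj i) g)"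
      by (simp add: act_diff)
    with dvd_diff[OF 3] show ?case by (simp only:)
  qed
qed

lemma pi_op_mult:
  "(X i - X (Suc i)) * pi_op i f = X i * f - X (Suc i) * act (adj i) f"
proof -
  have "X i * f - X (Suc i) * act (adj i) f
      = (X i - X (Suc i)) * f + X (Suc i) * (f - act (adj i) f)"
    by (simp add: algebra_simps)
  then have "X i - X (Suc i) dvd X i * f - X (Suc i) * act (adj i) f"
    using diff_dvd_act[of i f] by simp
  then obtain g where g: "X i * f - X (Suc i) * act (adj i) f = (X i - X (Suc i)) * g"
    by (elim dvdE)
  then have "pi_op i f = g"
    unfolding pi_op_def using X_diff_nonzero[of i] by (intro the_equality) auto
  with g show ?thesis by simp
qed

section \<open>The group \<open>S\<^sub>\<infinity>\<close>, reduced words and Bruhat order\<close>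

definition word_perm :: "nat list \<Rightarrow> nat \<Rightarrow> nat" where
  "word_perm a = foldr (\<lambda>i u. adj i \<circ> u) a id"

text \<open>
  The group generated by the \<open>s\<^sub>i\<close> with \<open>i \<ge> 1\<close>; no inverses are needed, as the \<open>s\<^sub>i\<close> are
  involutions.
\<close>

definition S_inf :: "(nat \<Rightarrow> nat) set" where
  "S_inf = {word_perm a | a. set a \<subseteq> {1..}}"

definition len :: "(nat \<Rightarrow> nat) \<Rightarrow> nat" where
  "len w = (LEAST n. \<exists>a. set a \<subseteq> {1..} \<and> word_perm a = w \<and> length a = n)"

definition reduced_word :: "nat list \<Rightarrow> (nat \<Rightarrow> nat) \<Rightarrow> bool" where
  "reduced_word a w \<longleftrightarrow> set a \<subseteq> {1..} \<and> word_perm a = w \<and> length a = len w"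

text \<open>
  The operators are taken along an arbitrarily chosen reduced word of \<open>w\<close>. By the braid relations,
  the choice does not matter.
\<close>

definition pi_perm :: "(nat \<Rightarrow> nat) \<Rightarrow> ipoly \<Rightarrow> ipoly" where
  "pi_perm w f = foldr pi_op (SOME a. reduced_word a w) f"

definition pi_bar_perm :: "(nat \<Rightarrow> nat) \<Rightarrow> ipoly \<Rightarrow> ipoly" where
  "pi_bar_perm w f = foldr pi_bar_op (SOME a. reduced_word a w) f"

definition bruhat_step :: "(nat \<Rightarrow> nat) \<Rightarrow> (nat \<Rightarrow> nat) \<Rightarrow> bool" where
  "bruhat_step u v \<longleftrightarrow>
     u \<in> S_inf \<and> (\<exists>i j. 1 \<le> i \<and> i < j \<and> v = u \<circ> transpose i j) \<and> len u < len v"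

definition bruhat_le :: "(nat \<Rightarrow> nat) \<Rightarrow> (nat \<Rightarrow> nat) \<Rightarrow> bool" where
  "bruhat_le = bruhat_step\<^sup>*\<^sup>*"

section \<open>Strict partitions and the key polynomials\<close>

text \<open>The parts are \<open>\<mu> 1 \<ge> \<mu> 2 \<ge> \<dots>\<close>; the value \<open>\<mu> 0\<close> is irrelevant.\<close>

definition partition :: "(nat \<Rightarrow> nat) \<Rightarrow> bool" where
  "partition \<mu> \<longleftrightarrow> (\<forall>i\<ge>1. \<mu> (Suc i) \<le> \<mu> i) \<and> finite {i. 1 \<le> i \<and> \<mu> i \<noteq> 0}"

definition strict_partition :: "(nat \<Rightarrow> nat) \<Rightarrow> bool" where
  "strict_partition \<mu> \<longleftrightarrow> partition \<mu> \<and> inj_on \<mu> {i. 1 \<le> i \<and> \<mu> i \<noteq> 0}"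

definition diagram :: "(nat \<Rightarrow> nat) \<Rightarrow> (nat \<times> nat) set" where
  "diagram \<mu> = {(i, j). 1 \<le> i \<and> 1 \<le> j \<and> j \<le> \<mu> i}"

lemma finite_diagram:
  assumes "partition \<mu>"
  shows "finite (diagram \<mu>)"
proof (rule finite_subset)
  show "diagram \<mu> \<subseteq> (SIGMA i:{i. 1 \<le> i \<and> \<mu> i \<noteq> 0}. {1..\<mu> i})"
    by (auto simp: diagram_def)
  show "finite (SIGMA i:{i. 1 \<le> i \<and> \<mu> i \<noteq> 0}. {1..\<mu> i})"
    using assms by (auto simp: partition_def)
qed

definition kappa_P :: "(nat \<Rightarrow> nat) \<Rightarrow> (nat \<Rightarrow> nat) \<Rightarrow> ipoly" where
  "kappa_P w \<mu> = pi_perm w (\<Prod>(i, j)\<in>diagram \<mu>. X i + X (i + j))"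

definition kappa_Q :: "(nat \<Rightarrow> nat) \<Rightarrow> (nat \<Rightarrow> nat) \<Rightarrow> ipoly" where
  "kappa_Q w \<mu> = pi_perm w (\<Prod>(i, j)\<in>diagram \<mu>. X i + X (i + j - 1))"

definition kappa_bar_P :: "(nat \<Rightarrow> nat) \<Rightarrow> (nat \<Rightarrow> nat) \<Rightarrow> ipoly" where
  "kappa_bar_P w \<mu> = pi_bar_perm w (\<Prod>(i, j)\<in>diagram \<mu>. X i + X (i + j))"

definition kappa_bar_Q :: "(nat \<Rightarrow> nat) \<Rightarrow> (nat \<Rightarrow> nat) \<Rightarrow> ipoly" where
  "kappa_bar_Q w \<mu> = pi_bar_perm w (\<Prod>(i, j)\<in>diagram \<mu>. X i + X (i + j - 1))"

end

theory Submission
  imports Defs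
begin

text \<open>
  The identity is one between operators, \<open>\<pi>\<^sub>w = \<Sum>\<^bsub>v \<le> w\<^esub> \<pi>'\<^sub>v\<close> with
  \<open>\<pi>'\<^sub>i = \<pi>\<^sub>i - 1\<close>, and is proved by induction on the length of \<open>w\<close>.

  Write \<open>w = s\<^sub>i x\<close> with \<open>x\<close> shorter than \<open>w\<close> and assume the identity for \<open>x\<close>.
  Since \<open>\<pi>'\<^sub>i \<pi>'\<^sub>i = - \<pi>'\<^sub>i\<close>, the operator \<open>\<pi>\<^sub>i = 1 + \<pi>'\<^sub>i\<close> annihilates
  \<open>\<pi>'\<^sub>v\<close> when \<open>s\<^sub>i v < v\<close>, and it sends \<open>\<pi>'\<^sub>v\<close> to \<open>\<pi>'\<^sub>v + \<pi>'\<^bsub>s\<^sub>i v\<^esub>\<close>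
  when \<open>s\<^sub>i v > v\<close>. So \<open>\<pi>\<^sub>w\<close> is the sum of \<open>\<pi>'\<close> over \<open>U \<union> s\<^sub>i U\<close>, where \<open>U\<close> consists
  of the \<open>v \<le> x\<close> with \<open>s\<^sub>i v > v\<close>. By the lifting property of the Bruhat order this union is
  exactly the set of the \<open>v \<le> w\<close> (lemma \<open>bruhat_interval_adj_comp\<close>).

  Two facts have to be in place for this. The equation \<open>\<pi>'\<^sub>i \<pi>'\<^sub>v = \<pi>'\<^bsub>s\<^sub>i v\<^esub>\<close> presupposes
  that \<open>\<pi>'\<^sub>v\<close> does not depend on the reduced word; this is Matsumoto's theorem (lemma
  \<open>foldr_reduced_word_unique\<close>) together with the braid relations for \<open>\<pi>'\<close>. And the length has to
  be compared with the order of values: \<open>w (a b)\<close> with \<open>a < b\<close> is longer than \<open>w\<close> iff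
  \<open>w a < w b\<close>. The latter comes from the strong exchange condition and yields all that is needed
  about descents and the Bruhat order.
\<close>

section \<open>Words and the exchange condition\<close>

lemma word_perm_Nil [simp]: "word_perm [] = id"
  by (simp add: word_perm_def)

lemma word_perm_Cons [simp]: "word_perm (i # a) = adj i \<circ> word_perm a"
  by (simp add: word_perm_def)

lemma word_perm_append: "word_perm (a @ b) = word_perm a \<circ> word_perm b"
  by (induction a) (simp_all add: o_assoc)

lemma bij_word_perm: "bij (word_perm a)"
  by (induction a) (simp_all only: word_perm_Nil word_perm_Cons bij_id bij_comp bij_transpose)

lemma word_perm_0: "set a \<subseteq> {1..} \<Longrightarrow> word_perm a 0 = 0"
  by (induction a) (auto simp: transpose_def)

lemma adj_adj_comp [simp]: "adj i \<circ> (adj i \<circ> w) = w"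
  by (simp add: o_assoc)

lemma S_inf_bij: "w \<in> S_inf \<Longrightarrow> bij w"
  by (auto simp: S_inf_def bij_word_perm)

lemma S_inf_0: "w \<in> S_inf \<Longrightarrow> w 0 = 0"
  by (auto simp: S_inf_def word_perm_0)

lemma S_inf_comp:
  assumes "u \<in> S_inf" "v \<in> S_inf"
  shows "u \<circ> v \<in> S_inf"
proof -
  obtain a b where ab: "set a \<subseteq> {1..}" "u = word_perm a" "set b \<subseteq> {1..}" "v = word_perm b"
    using assms by (auto simp: S_inf_def)
  then have "u \<circ> v = word_perm (a @ b)" "set (a @ b) \<subseteq> {1..}"
    by (auto simp: word_perm_append)
  then show ?thesis unfolding S_inf_def by blast
qed

lemma adj_in_S_inf: "1 \<le> i \<Longrightarrow> adj i \<in> S_inf"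
  unfolding S_inf_def by (rule CollectI, rule exI[of _ "[i]"]) simp

lemma transpose_in_S_inf:
  assumes "1 \<le> i" "i < j"
  shows "transpose i j \<in> S_inf"
  using assms(2)
proof (induction j)
  case (Suc j)
  show ?case
  proof (cases "i = j")
    case True
    then show ?thesis using adj_in_S_inf assms by simp
  next
    case False
    then have "transpose i (Suc j) = adj j \<circ> (transpose i j \<circ> adj j)"
      using Suc.prems by (auto simp: fun_eq_iff transpose_def)
    moreover have "transpose i j \<in> S_inf" using False Suc by simp
    ultimately show ?thesis using assms Suc.prems by (simp only: S_inf_comp adj_in_S_inf)
  qed
qed simp

lemma reduced_word_exists:
  assumes "w \<in> S_inf"
  obtains a where "reduced_word a w"
proof -
  have "\<exists>n. \<exists>a. set a \<subseteq> {1..} \<and> word_perm a = w \<and> length a = n"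
    using assms by (auto simp: S_inf_def)
  from LeastI_ex[OF this] that show ?thesis
    unfolding reduced_word_def len_def by blast
qed

lemma reduced_word_some: "w \<in> S_inf \<Longrightarrow> reduced_word (SOME a. reduced_word a w) w"
  by (metis reduced_word_exists someI)

lemma reduced_word_in_S_inf: "reduced_word a w \<Longrightarrow> w \<in> S_inf"
  by (auto simp: reduced_word_def S_inf_def)

lemma len_le_length:
  "set a \<subseteq> {1..} \<Longrightarrow> len (word_perm a) \<le> length a"
  unfolding len_def by (rule Least_le) blast

lemma comp_transpose: "bij w \<Longrightarrow> w \<circ> transpose a b = transpose (w a) (w b) \<circ> w"
  by (auto simp: fun_eq_iff transpose_def bij_def inj_eq)

lemma adj_order_reversal:
  assumes "x < y" "adj i y < adj i x"
  shows "x = i \<and> y = Suc i"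
  using assms by (auto simp: transpose_def split: if_splits)

text \<open>
  Reading the word from the right, the images of \<open>a < b\<close> start in increasing order and
  end in decreasing order, so some letter \<open>i\<close> reverses them. At that moment the two images are
  \<open>i\<close> and \<open>i + 1\<close>, and dropping the letter has the same effect as first exchanging \<open>a\<close> and \<open>b\<close>.
\<close>

lemma strong_exchange:
  assumes "a < b" "word_perm c b < word_perm c a"
  shows "\<exists>c'. set c' \<subseteq> set c \<and> length c = Suc (length c') \<and> word_perm c' = word_perm c \<circ> transpose a b"
  using assms(2)
proof (induction c)
  case Nil
  then show ?case using assms(1) by simp
next
  case (Cons i c)
  let ?u = "word_perm c"
  show ?case
  proof (cases "?u b < ?u a")
    case True
    from Cons.IH[OF this] obtain c' where
      "set c' \<subseteq> set c" "length c = Suc (length c')" "word_perm c' = ?u \<circ> transpose a b" by blast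
    then show ?thesis by (intro exI[of _ "i # c'"]) (auto simp: o_assoc)
  next
    case False
    \<comment> \<open>The leading letter is the one that reverses the pair.\<close>
    have "?u a \<noteq> ?u b"
      using assms(1) bij_word_perm[of c] by (auto simp: bij_def inj_eq)
    with False have "?u a < ?u b" by simp
    with Cons.prems have "?u a = i" "?u b = Suc i"
      using adj_order_reversal[of "?u a" "?u b" i] by auto
    then have "word_perm (i # c) \<circ> transpose a b = ?u"
      by (simp add: comp_transpose[OF bij_word_perm] o_assoc[symmetric])
    then have "word_perm c = word_perm (i # c) \<circ> transpose a b" by (rule sym)
    then show ?thesis by (intro exI[of _ c] conjI) (auto simp only: set_subset_Cons list.size)
  qed
qed

text \<open>
  The exchanged word is one letter shorter than a reduced word of \<open>w\<close>, so a decreasing pair of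
  values makes the length drop. For an increasing pair, \<open>w (a b)\<close> has the decreasing one.
\<close>

lemma len_comp_transpose_less:
  assumes "w \<in> S_inf" "a < b" "w b < w a"
  shows "len (w \<circ> transpose a b) < len w"
proof -
  obtain c where c: "reduced_word c w" using reduced_word_exists assms(1) by blast
  then obtain c' where c': "set c' \<subseteq> set c" "length c = Suc (length c')"
      "word_perm c' = w \<circ> transpose a b"
    using strong_exchange[of a b c] assms by (auto simp: reduced_word_def)
  then have "len (w \<circ> transpose a b) \<le> length c'"
    using len_le_length[of c'] c by (auto simp: reduced_word_def)
  then show ?thesis using c c'(2) by (simp add: reduced_word_def)
qed

lemma len_less_comp_transpose_iff:
  assumes "w \<in> S_inf" "1 \<le> a" "a < b"
  shows "len w < len (w \<circ> transpose a b) \<longleftrightarrow> w a < w b"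
proof
  assume less: "len w < len (w \<circ> transpose a b)"
  have "w a \<noteq> w b" using assms S_inf_bij[OF assms(1)] by (auto simp: bij_def inj_eq)
  then show "w a < w b" using len_comp_transpose_less[OF assms(1,3)] less by fastforce
next
  assume "w a < w b"
  moreover have "w \<circ> transpose a b \<in> S_inf"
    using assms by (simp add: S_inf_comp transpose_in_S_inf)
  ultimately show "len w < len (w \<circ> transpose a b)"
    using len_comp_transpose_less[of "w \<circ> transpose a b" a b] assms(3)
    by (simp add: o_assoc[symmetric])
qed

section \<open>Left descents\<close>

definition left_descent :: "nat \<Rightarrow> (nat \<Rightarrow> nat) \<Rightarrow> bool" where
  "left_descent i w \<longleftrightarrow> inv w (Suc i) < inv w i"

lemma inv_adj_comp: "bij w \<Longrightarrow> inv (adj i \<circ> w) k = inv w (adj i k)"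
  by (simp add: o_inv_distrib)

lemma not_left_descent_iff: "bij w \<Longrightarrow> \<not> left_descent i w \<longleftrightarrow> inv w i < inv w (Suc i)"
  by (metis bij_imp_bij_inv bij_is_inj inj_eq left_descent_def n_not_Suc_n not_less_iff_gr_or_eq)

lemma left_descent_adj_comp: "bij w \<Longrightarrow> left_descent i (adj i \<circ> w) \<longleftrightarrow> \<not> left_descent i w"
  by (simp add: not_left_descent_iff) (simp add: left_descent_def inv_adj_comp)

lemma len_adj_comp_le:
  assumes "w \<in> S_inf" "1 \<le> i"
  shows "len (adj i \<circ> w) \<le> Suc (len w)"
proof -
  obtain a where a: "reduced_word a w" using reduced_word_exists assms(1) by blast
  then show ?thesis using len_le_length[of "i # a"] assms(2) by (simp add: reduced_word_def)
qed

text \<open>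
  Exchanging the values \<open>i\<close> and \<open>i + 1\<close> is exchanging the positions at which they are taken, so
  left multiplication by \<open>s\<^sub>i\<close> is covered by the comparison of lengths for right multiplication.
\<close>

lemma len_adj_comp_ascent:
  assumes "w \<in> S_inf" "1 \<le> i" "\<not> left_descent i w"
  shows "len (adj i \<circ> w) = Suc (len w)"
proof -
  have bij: "bij w" by (rule S_inf_bij[OF assms(1)])
  then have w_inv: "w (inv w k) = k" for k by (simp add: bij_is_surj surj_f_inv_f)
  have less: "inv w i < inv w (Suc i)"
    using assms(3) bij not_left_descent_iff by blast
  have "inv w i \<noteq> 0"
    using w_inv[of i] S_inf_0[OF assms(1)] assms(2) by (intro notI) simp
  then have "len w < len (w \<circ> transpose (inv w i) (inv w (Suc i)))"
    using len_less_comp_transpose_iff[OF assms(1), of "inv w i" "inv w (Suc i)"] less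
    by (simp add: w_inv)
  then have "len w < len (adj i \<circ> w)"
    by (simp add: comp_transpose[OF bij] w_inv)
  then show ?thesis using len_adj_comp_le[OF assms(1,2)] by simp
qed

lemma len_adj_comp_descent:
  assumes "w \<in> S_inf" "1 \<le> i" "left_descent i w"
  shows "Suc (len (adj i \<circ> w)) = len w"
  using len_adj_comp_ascent[of "adj i \<circ> w" i] assms
  by (simp add: S_inf_comp adj_in_S_inf left_descent_adj_comp S_inf_bij)

text \<open>
  Reducedness of a word can thus be tested letter by letter, without computing lengths.
\<close>

lemma reduced_word_Cons_iff:
  "reduced_word (i # a) w \<longleftrightarrow> 1 \<le> i \<and> left_descent i w \<and> reduced_word a (adj i \<circ> w)"
proof
  assume r: "reduced_word (i # a) w"
  then have w: "w = adj i \<circ> word_perm a" and i: "1 \<le> i" and a: "set a \<subseteq> {1..}"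
    and l: "len w = Suc (length a)"
    by (auto simp: reduced_word_def)
  have S: "w \<in> S_inf" by (rule reduced_word_in_S_inf[OF r])
  have tail: "adj i \<circ> w = word_perm a" using w by simp
  have "len (adj i \<circ> w) \<le> length a" using len_le_length[OF a] tail by simp
  then have "left_descent i w" using len_adj_comp_ascent[OF S i] l by fastforce
  moreover from len_adj_comp_descent[OF S i this] have "reduced_word a (adj i \<circ> w)"
    using a tail l by (simp add: reduced_word_def)
  ultimately show "1 \<le> i \<and> left_descent i w \<and> reduced_word a (adj i \<circ> w)" using i by simp
next
  assume r: "1 \<le> i \<and> left_descent i w \<and> reduced_word a (adj i \<circ> w)"
  then have "adj i \<circ> (adj i \<circ> w) \<in> S_inf"
    by (blast intro: S_inf_comp adj_in_S_inf reduced_word_in_S_inf)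
  then have S: "w \<in> S_inf" by simp
  have "word_perm (i # a) = adj i \<circ> (adj i \<circ> w)"
    using r by (simp add: reduced_word_def)
  then have "word_perm (i # a) = w" by simp
  then show "reduced_word (i # a) w"
    using r len_adj_comp_descent[OF S, of i] by (simp add: reduced_word_def)
qed

section \<open>Independence of the reduced word\<close>

lemma adj_comp_commute:
  "Suc i < j \<Longrightarrow> adj i \<circ> (adj j \<circ> w) = adj j \<circ> (adj i \<circ> w)"
  by (auto simp: fun_eq_iff transpose_def)

lemma adj_comp_braid:
  "adj i \<circ> (adj (Suc i) \<circ> (adj i \<circ> w)) = adj (Suc i) \<circ> (adj i \<circ> (adj (Suc i) \<circ> w))"
  by (auto simp: fun_eq_iff transpose_def)

text \<open>
  Two reduced words starting with \<open>i\<close> and \<open>j\<close> show that \<open>w\<close> has the left descents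
  \<open>i\<close> and \<open>j\<close>, and then \<open>w\<close> has reduced words starting with either side of the braid relation
  between \<open>s\<^sub>i\<close> and \<open>s\<^sub>j\<close>, with a common tail.
  The induction hypothesis links each given word to one of these two.
\<close>

lemma foldr_reduced_word_unique:
  fixes ops :: "nat \<Rightarrow> 'a \<Rightarrow> 'a"
  assumes comm: "\<And>i j x. Suc i < j \<Longrightarrow> ops i (ops j x) = ops j (ops i x)"
    and braid: "\<And>i x. ops i (ops (Suc i) (ops i x)) = ops (Suc i) (ops i (ops (Suc i) x))"
    and "reduced_word a w" "reduced_word b w"
  shows "foldr ops a x = foldr ops b x"
  using assms(3,4)
proof (induction "length a" arbitrary: a b w rule: less_induct)
  case less
  have lens: "length a = length b" using less.prems by (simp add: reduced_word_def)
  have step: "foldr ops (i # a') x = foldr ops (j # b') x"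
    if IH: "\<And>c d u. \<lbrakk>length c < Suc (length a'); reduced_word c u; reduced_word d u\<rbrakk>
        \<Longrightarrow> foldr ops c x = foldr ops d x"
      and a: "reduced_word (i # a') w" and b: "reduced_word (j # b') w"
      and ij: "i < j" and l: "length a' = length b'" for i j a' b'
  proof -
    note iffs = reduced_word_Cons_iff
    have S: "w \<in> S_inf" by (rule reduced_word_in_S_inf[OF a])
    have bij: "bij w" by (rule S_inf_bij[OF S])
    have i: "1 \<le> i" "left_descent i w" "reduced_word a' (adj i \<circ> w)" using a iffs by blast+
    have j: "1 \<le> j" "left_descent j w" "reduced_word b' (adj j \<circ> w)" using b iffs by blast+
    show ?thesis
    proof (cases "j = Suc i")
      case False
      then have far: "Suc i < j" using ij by simp
      have "adj j \<circ> (adj i \<circ> w) \<in> S_inf"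
        by (intro S_inf_comp adj_in_S_inf S i(1) j(1))
      then obtain c where c: "reduced_word c (adj j \<circ> (adj i \<circ> w))"
        using reduced_word_exists by blast
      have "left_descent j (adj i \<circ> w)" "left_descent i (adj j \<circ> w)"
        using i(2) j(2) far unfolding left_descent_def by (simp_all add: inv_adj_comp bij transpose_def)
      then have rc: "reduced_word (j # c) (adj i \<circ> w)" "reduced_word (i # c) (adj j \<circ> w)"
        using c i(1) j(1) adj_comp_commute[OF far, of w] by (simp_all add: iffs)
      have "foldr ops a' x = foldr ops (j # c) x" using IH[OF _ i(3) rc(1)] by simp
      moreover have "foldr ops b' x = foldr ops (i # c) x" using IH[OF _ j(3) rc(2)] l by simp
      ultimately show ?thesis by (simp add: comm[OF far])
    next
      case True
      have "adj i \<circ> (adj j \<circ> (adj i \<circ> w)) \<in> S_inf"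
        by (intro S_inf_comp adj_in_S_inf S i(1) j(1))
      then obtain c where c: "reduced_word c (adj i \<circ> (adj j \<circ> (adj i \<circ> w)))"
        using reduced_word_exists by blast
      have "left_descent j (adj i \<circ> w)" "left_descent i (adj j \<circ> (adj i \<circ> w))"
        "left_descent i (adj j \<circ> w)" "left_descent j (adj i \<circ> (adj j \<circ> w))"
        using i(2) j(2) True unfolding left_descent_def
        by (simp_all add: inv_adj_comp bij bij_comp transpose_def)
      then have rc: "reduced_word (j # i # c) (adj i \<circ> w)" "reduced_word (i # j # c) (adj j \<circ> w)"
        using c i(1) j(1) adj_comp_braid[of i w] True by (simp_all add: iffs)
      have "foldr ops a' x = foldr ops (j # i # c) x" using IH[OF _ i(3) rc(1)] by simp
      moreover have "foldr ops b' x = foldr ops (i # j # c) x" using IH[OF _ j(3) rc(2)] l by simp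
      ultimately show ?thesis using True by (simp add: braid)
    qed
  qed
  show ?case
  proof (cases a)
    case Nil
    then show ?thesis using lens by simp
  next
    case (Cons i a')
    then obtain j b' where b: "b = j # b'" using lens by (cases b) auto
    have l: "length a' = length b'" using lens Cons b by simp
    have IH: "foldr ops c x = foldr ops d x"
      if "length c < Suc (length a')" "reduced_word c u" "reduced_word d u" for c d u
      by (rule less.hyps[OF _ that(2,3)]) (use that(1) Cons in simp)
    have ra: "reduced_word (i # a') w" and rb: "reduced_word (j # b') w"
      using less.prems Cons b by (simp_all only:)
    consider "i = j" | "i < j" | "j < i" by linarith
    then show ?thesis
    proof cases
      case 1
      then have "reduced_word a' (adj i \<circ> w)" "reduced_word b' (adj i \<circ> w)"
        using ra rb unfolding reduced_word_Cons_iff by blast+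
      then have "foldr ops a' x = foldr ops b' x" by (rule IH[OF lessI])
      then show ?thesis using 1 Cons b by simp
    next
      case 2
      show ?thesis unfolding Cons b by (rule step[OF IH ra rb 2 l])
    next
      case 3
      show ?thesis unfolding Cons b
        by (rule step[OF IH[unfolded l] rb ra 3 l[symmetric], symmetric])
    qed
  qed
qed

section \<open>Relations between the divided differences\<close>

lemma act_comp:
  assumes "bij v" "bij w"
  shows "act v (act w f) = act (v \<circ> w) f"
proof -
  have "Poly_Mapping.map_key w \<circ> Poly_Mapping.map_key v
      = (Poly_Mapping.map_key (v \<circ> w) :: (nat \<Rightarrow>\<^sub>0 nat) \<Rightarrow> _)"
    using assms by (simp add: fun_eq_iff map_key_compose bij_is_inj)
  then show ?thesis
    using assms by (simp add: act_def map_key_compose inj_map_key)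
qed

lemma act_id: "act id f = f"
proof -
  note id = map_key_id[unfolded id_def[symmetric]]
  have "Poly_Mapping.map_key id = (id :: (nat \<Rightarrow>\<^sub>0 nat) \<Rightarrow> _)"
    by (rule ext) (simp add: id)
  then show ?thesis by (simp add: act_def id)
qed

lemma X_eq_iff: "X i = X j \<longleftrightarrow> i = j"
proof
  assume "X i = X j"
  then have "Poly_Mapping.keys (X i) = Poly_Mapping.keys (X j)" by simp
  then have "Poly_Mapping.keys (Poly_Mapping.single i (1::nat)) = Poly_Mapping.keys (Poly_Mapping.single j (1::nat))"
    by (simp add: X_def)
  then show "i = j" by simp
qed simp

lemma pi_bar_op_mult:
  "(X i - X (Suc i)) * pi_bar_op i f = X (Suc i) * (f - act (adj i) f)"
proof -
  have "(X i - X (Suc i)) * pi_bar_op i f = (X i - X (Suc i)) * pi_op i f - (X i - X (Suc i)) * f"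
    by (simp add: pi_bar_op_def right_diff_distrib)
  then show ?thesis by (simp only: pi_op_mult) (simp add: algebra_simps)
qed

text \<open>
  The ring is a domain, so the quotient is determined by this product. The relations below are
  all proved by clearing denominators and cancelling.
\<close>

lemma pi_bar_op_eqI:
  assumes "(X i - X (Suc i)) * g = X (Suc i) * (f - act (adj i) f)"
  shows "pi_bar_op i f = g"
  by (rule mult_left_cancel[OF X_diff_nonzero[of i], THEN iffD1]) (simp only: pi_bar_op_mult assms)

lemma pi_bar_op_add: "pi_bar_op i (f + g) = pi_bar_op i f + pi_bar_op i g"
  by (rule pi_bar_op_eqI)
    (simp only: distrib_left[of "X i - X (Suc i)"] pi_bar_op_mult,
      simp add: act_add algebra_simps)

lemma pi_bar_op_0: "pi_bar_op i 0 = 0"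
  by (rule pi_bar_op_eqI) (simp add: act_zero)

lemma pi_bar_op_sum: "pi_bar_op i (sum g A) = (\<Sum>v\<in>A. pi_bar_op i (g v))"
  by (induction A rule: infinite_finite_induct) (simp_all add: pi_bar_op_0 pi_bar_op_add)

lemma act_pi_bar_op:
  assumes "bij w"
  shows "(X (w i) - X (w (Suc i))) * act w (pi_bar_op i f)
    = X (w (Suc i)) * (act w f - act (w \<circ> adj i) f)"
  using arg_cong[OF pi_bar_op_mult[of i f], of "act w"] assms
  by (simp add: act_mult act_diff act_X act_comp)

text \<open>
  The quotient \<open>h\<close> of \<open>f - s\<^sub>i f\<close> by \<open>x\<^sub>i - x\<^bsub>i+1\<^esub>\<close> is fixed by \<open>s\<^sub>i\<close>, and
  \<open>g = \<pi>'\<^sub>i f\<close> is \<open>x\<^bsub>i+1\<^esub> h\<close>;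
  hence \<open>g - s\<^sub>i g = - (f - s\<^sub>i f)\<close>.
\<close>

lemma pi_bar_op_idem: "pi_bar_op i (pi_bar_op i f) = - pi_bar_op i f"
proof (rule pi_bar_op_eqI)
  let ?d = "X i - X (Suc i)" and ?g = "pi_bar_op i f" and ?s = "act (adj i)"
  have "?d * ?s ?g = X i * (f - ?s f)"
    using act_pi_bar_op[OF bij_transpose, of i "Suc i" i f]
    unfolding transpose_comp_involutory act_id transpose_apply_first transpose_apply_second
    by algebra
  then have "?d * (?g - ?s ?g) = ?d * - (f - ?s f)"
    using pi_bar_op_mult[of i f] by algebra
  then have "?g - ?s ?g = - (f - ?s f)"
    by (rule mult_left_cancel[OF X_diff_nonzero[of i], THEN iffD1])
  then show "?d * - ?g = X (Suc i) * (?g - ?s ?g)"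
    by (simp only: mult_minus_right pi_bar_op_mult)
qed

text \<open>
  The braid relation holds because both triple products, multiplied by
  \<open>(x - y) (y - z) (x - z)\<close>, equal \<open>y z\<^sup>2\<close> times the alternating sum of the images of \<open>f\<close> under
  the group generated by \<open>s = s\<^sub>i\<close> and \<open>t = s\<^bsub>i+1\<^esub>\<close>. The next two lemmas are this
  computation for the left and the right side, with \<open>x, y, z\<close> for the three variables involved. A
  name such as \<open>f_ts\<close> or \<open>tf1\<close> stands for the image of \<open>f\<close> under \<open>t s\<close> or of \<open>f1\<close>
  under \<open>t\<close>, and \<open>f_w\<close> for the image of \<open>f\<close> under \<open>s t s = t s t\<close>; \<open>f1, f2, f3\<close> and
  \<open>g1, g2, g3\<close> are the successive results of the operators.
\<close>

lemma braid_numerator_left: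
  fixes x y z :: "'a :: idom"
  assumes nz: "x \<noteq> y" "y \<noteq> z" "x \<noteq> z"
    and f1: "(x - y) * f1 = y * (f - f_s)" "(x - z) * tf1 = z * (f_t - f_ts)"
      "(y - x) * sf1 = x * (f_s - f)" "(y - z) * stf1 = z * (f_st - f_w)"
    and f2: "(y - z) * f2 = z * (f1 - tf1)" "(x - z) * sf2 = z * (sf1 - stf1)"
    and f3: "(x - y) * f3 = y * (f2 - sf2)"
  shows "(x - y) * (y - z) * (x - z) * f3 = y * z^2 * (f - f_s - f_t + f_ts + f_st - f_w)"
proof -
  have a: "(x - y) * (x - z) * (y - z) * f2 = z * ((x - z) * y * (f - f_s) - (x - y) * z * (f_t - f_ts))"
    using f1(1,2) f2(1) by algebra
  have b: "(x - y) * (x - z) * (y - z) * sf2 = z * ((y - z) * x * (f - f_s) - (x - y) * z * (f_st - f_w))"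
    using f1(3,4) f2(2) by algebra
  have "(x - y) * ((x - y) * (y - z) * (x - z) * f3)
      = y * ((x - y) * (x - z) * (y - z) * f2 - (x - y) * (x - z) * (y - z) * sf2)"
    using f3 by algebra
  also have "\<dots> = (x - y) * (y * z^2 * (f - f_s - f_t + f_ts + f_st - f_w))"
    unfolding a b by algebra
  finally show ?thesis using nz(1) by simp
qed

lemma braid_numerator_right:
  fixes x y z :: "'a :: idom"
  assumes nz: "x \<noteq> y" "y \<noteq> z" "x \<noteq> z"
    and g1: "(y - z) * g1 = z * (f - f_t)" "(x - z) * sg1 = z * (f_s - f_st)"
      "(z - y) * tg1 = y * (f_t - f)" "(x - y) * tsg1 = y * (f_ts - f_w)"
    and g2: "(x - y) * g2 = y * (g1 - sg1)" "(x - z) * tg2 = z * (tg1 - tsg1)"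
    and g3: "(y - z) * g3 = z * (g2 - tg2)"
  shows "(x - y) * (y - z) * (x - z) * g3 = y * z^2 * (f - f_s - f_t + f_ts + f_st - f_w)"
proof -
  have a: "(x - y) * (x - z) * (y - z) * g2 = y * ((x - z) * z * (f - f_t) - (y - z) * z * (f_s - f_st))"
    using g1(1,2) g2(1) by algebra
  have b: "(x - y) * (x - z) * (y - z) * tg2 = z * ((x - y) * y * (f - f_t) - (y - z) * y * (f_ts - f_w))"
    using g1(3,4) g2(2) by algebra
  have "(y - z) * ((x - y) * (y - z) * (x - z) * g3)
      = z * ((x - y) * (x - z) * (y - z) * g2 - (x - y) * (x - z) * (y - z) * tg2)"
    using g3 by algebra
  also have "\<dots> = (y - z) * (y * z^2 * (f - f_s - f_t + f_ts + f_st - f_w))"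
    unfolding a b by algebra
  finally show ?thesis using nz(2) by simp
qed

lemma pi_bar_op_braid:
  "pi_bar_op i (pi_bar_op (Suc i) (pi_bar_op i f))
    = pi_bar_op (Suc i) (pi_bar_op i (pi_bar_op (Suc i) f))"
proof -
  let ?j = "Suc i"
  let ?x = "X i" and ?y = "X ?j" and ?z = "X (Suc ?j)"
  let ?s = "adj i" and ?t = "adj ?j"
  let ?f1 = "pi_bar_op i f" and ?g1 = "pi_bar_op ?j f"
  let ?f2 = "pi_bar_op ?j ?f1" and ?g2 = "pi_bar_op i ?g1"
  have nz: "?x \<noteq> ?y" "?y \<noteq> ?z" "?x \<noteq> ?z"
    by (simp_all add: X_eq_iff)
  have w: "?s \<circ> (?t \<circ> ?s) = ?t \<circ> (?s \<circ> ?t)"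
    using adj_comp_braid[of i id] by simp
  have bij: "bij ?s" "bij ?t" "bij (?s \<circ> ?t)" "bij (?t \<circ> ?s)"
    by (simp_all only: bij_transpose bij_comp)
  note act_rules = act_pi_bar_op[OF bij(1)] act_pi_bar_op[OF bij(2)]
    act_pi_bar_op[OF bij(3)] act_pi_bar_op[OF bij(4)]
  have "(?x - ?y) * (?y - ?z) * (?x - ?z) * pi_bar_op i ?f2 = ?y * ?z^2 *
      (f - act ?s f - act ?t f + act (?t \<circ> ?s) f + act (?s \<circ> ?t) f - act (?s \<circ> (?t \<circ> ?s)) f)"
  proof (rule braid_numerator_left[OF nz])
    show "(?x - ?y) * ?f1 = ?y * (f - act ?s f)" "(?y - ?z) * ?f2 = ?z * (?f1 - act ?t ?f1)"
      "(?x - ?y) * pi_bar_op i ?f2 = ?y * (?f2 - act ?s ?f2)"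
      by (rule pi_bar_op_mult)+
    show "(?x - ?z) * act ?t ?f1 = ?z * (act ?t f - act (?t \<circ> ?s) f)"
      using act_rules(2)[of i f] by simp
    show "(?y - ?x) * act ?s ?f1 = ?x * (act ?s f - f)"
      using act_rules(1)[of i f] by (simp add: act_id)
    show "(?y - ?z) * act (?s \<circ> ?t) ?f1 = ?z * (act (?s \<circ> ?t) f - act (?s \<circ> (?t \<circ> ?s)) f)"
      using act_rules(3)[of i f] by (simp add: o_assoc)
    show "(?x - ?z) * act ?s ?f2 = ?z * (act ?s ?f1 - act (?s \<circ> ?t) ?f1)"
      using act_rules(1)[of ?j ?f1] by simp
  qed
  also have "\<dots> = (?x - ?y) * (?y - ?z) * (?x - ?z) * pi_bar_op ?j ?g2"
  proof (rule braid_numerator_right[OF nz, symmetric])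
    show "(?y - ?z) * ?g1 = ?z * (f - act ?t f)" "(?x - ?y) * ?g2 = ?y * (?g1 - act ?s ?g1)"
      "(?y - ?z) * pi_bar_op ?j ?g2 = ?z * (?g2 - act ?t ?g2)"
      by (rule pi_bar_op_mult)+
    show "(?x - ?z) * act ?s ?g1 = ?z * (act ?s f - act (?s \<circ> ?t) f)"
      using act_rules(1)[of ?j f] by simp
    show "(?z - ?y) * act ?t ?g1 = ?y * (act ?t f - f)"
      using act_rules(2)[of ?j f] by (simp add: act_id)
    show "(?x - ?y) * act (?t \<circ> ?s) ?g1 = ?y * (act (?t \<circ> ?s) f - act (?s \<circ> (?t \<circ> ?s)) f)"
      using act_rules(4)[of ?j f] w by (simp add: o_assoc)
    show "(?x - ?z) * act ?t ?g2 = ?z * (act ?t ?g1 - act (?t \<circ> ?s) ?g1)"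
      using act_rules(2)[of i ?g1] by simp
  qed
  finally show ?thesis using nz by simp
qed

lemma pi_bar_op_commute:
  assumes "Suc i < j"
  shows "pi_bar_op i (pi_bar_op j f) = pi_bar_op j (pi_bar_op i f)"
proof (rule pi_bar_op_eqI)
  let ?s = "adj i" and ?t = "adj j"
  let ?d = "X i - X (Suc i)" and ?e = "X j - X (Suc j)"
  let ?f1 = "pi_bar_op i f" and ?g1 = "pi_bar_op j f"
  have st: "?s \<circ> ?t = ?t \<circ> ?s"
    using adj_comp_commute[OF assms, of id] by simp
  have s: "?e * act ?s ?g1 = X (Suc j) * (act ?s f - act (?s \<circ> ?t) f)"
    using act_pi_bar_op[of ?s j f] assms by simp
  have t: "?d * act ?t ?f1 = X (Suc i) * (act ?t f - act (?s \<circ> ?t) f)"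
    using act_pi_bar_op[of ?t i f] assms st by simp
  note e = pi_bar_op_mult[of i f] pi_bar_op_mult[of j f] pi_bar_op_mult[of j ?f1]
  have "?e * (?d * pi_bar_op j ?f1) = X (Suc j) * (?d * ?f1 - ?d * act ?t ?f1)"
    using e(3) by algebra
  also have "\<dots> = X (Suc i) * (?e * ?g1 - ?e * act ?s ?g1)"
    unfolding e(1,2) s t by (simp add: algebra_simps)
  also have "\<dots> = ?e * (X (Suc i) * (?g1 - act ?s ?g1))"
    by algebra
  finally show "?d * pi_bar_op j ?f1 = X (Suc i) * (?g1 - act ?s ?g1)"
    by (rule mult_left_cancel[OF X_diff_nonzero[of j], THEN iffD1])
qed

section \<open>The lifting property of the Bruhat order\<close>

lemma bruhat_le_trans: "bruhat_le u v \<Longrightarrow> bruhat_le v w \<Longrightarrow> bruhat_le u w"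
  unfolding bruhat_le_def by (rule rtranclp_trans)

lemma bruhat_step_le: "bruhat_step u v \<Longrightarrow> bruhat_le u v"
  by (simp add: bruhat_le_def)

lemma bruhat_step_adj_comp:
  assumes "w \<in> S_inf" "1 \<le> i" "\<not> left_descent i w"
  shows "bruhat_step w (adj i \<circ> w)"
proof -
  have bij: "bij w" by (rule S_inf_bij[OF assms(1)])
  then have w_inv: "w (inv w k) = k" for k by (simp add: bij_is_surj surj_f_inv_f)
  have less: "inv w i < inv w (Suc i)"
    using assms(3) bij not_left_descent_iff by blast
  have "inv w i \<noteq> 0"
    using w_inv[of i] S_inf_0[OF assms(1)] assms(2) by (intro notI) simp
  moreover have "w \<circ> transpose (inv w i) (inv w (Suc i)) = adj i \<circ> w"
    by (simp add: comp_transpose[OF bij] w_inv)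
  moreover have "len w < len (adj i \<circ> w)"
    using len_adj_comp_ascent[OF assms] by simp
  ultimately show ?thesis
    using less assms(1) unfolding bruhat_step_def
    by (metis One_nat_def Suc_leI gr0I)
qed

text \<open>
  A step exchanges two values in increasing order. Left multiplication by \<open>s\<^sub>i\<close> keeps
  these two values in order, so that the step survives, unless they are \<open>i\<close> and \<open>i + 1\<close>; in this
  case the step is itself left multiplication by \<open>s\<^sub>i\<close>.
\<close>

lemma bruhat_step_lift:
  assumes "bruhat_step u v" "1 \<le> i"
  shows "adj i \<circ> u = v \<or> bruhat_step (adj i \<circ> u) (adj i \<circ> v)"
proof -
  obtain a b where ab: "u \<in> S_inf" "1 \<le> a" "a < b" "v = u \<circ> transpose a b" "len u < len v"
    using assms(1) by (auto simp only: bruhat_step_def)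
  have less: "u a < u b"
    using len_less_comp_transpose_iff[OF ab(1-3)] ab(4,5) by simp
  have S: "adj i \<circ> u \<in> S_inf" by (intro S_inf_comp adj_in_S_inf ab(1) assms(2))
  show ?thesis
  proof (cases "adj i (u a) < adj i (u b)")
    case True
    then have "len (adj i \<circ> u) < len ((adj i \<circ> u) \<circ> transpose a b)"
      using len_less_comp_transpose_iff[OF S ab(2,3)] by simp
    then show ?thesis
      using S ab(2-4) unfolding bruhat_step_def by (metis o_assoc)
  next
    case False
    have "adj i (u a) \<noteq> adj i (u b)"
      using less by (metis less_irrefl transpose_involutory)
    with False have "u a = i" "u b = Suc i"
      using adj_order_reversal[OF less, of i] by auto
    then have "v = adj i \<circ> u"
      using comp_transpose[OF S_inf_bij[OF ab(1)], of a b] ab(4) by simp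
    then show ?thesis by simp
  qed
qed

lemma bruhat_le_lift:
  assumes "bruhat_le u v" "1 \<le> i"
  shows "bruhat_le (adj i \<circ> u) v \<or> bruhat_le (adj i \<circ> u) (adj i \<circ> v)"
  using assms(1) unfolding bruhat_le_def
proof (induction rule: converse_rtranclp_induct)
  case (step y z)
  then show ?case
    using bruhat_step_lift[OF step.hyps(1) assms(2)] by (metis converse_rtranclp_into_rtranclp)
qed simp

text \<open>
  By induction along a chain from \<open>v\<close> to \<open>w\<close> with last step from \<open>y\<close> to \<open>z\<close>. If this step is
  left multiplication by \<open>s\<^sub>i\<close>, then \<open>s\<^sub>i z = y\<close> lies on the chain. Otherwise \<open>s\<^sub>i y\<close> is below
  \<open>s\<^sub>i z\<close>, and \<open>v\<close> is below \<open>s\<^sub>i y\<close>: by the induction hypothesis if \<open>i\<close> is a descent of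
  \<open>y\<close>, and because of \<open>v \<le> y < s\<^sub>i y\<close> if not.
\<close>

lemma bruhat_le_adj_comp_of_descent:
  assumes "bruhat_le v w" "v \<in> S_inf" "1 \<le> i" "\<not> left_descent i v" "left_descent i w"
  shows "bruhat_le v (adj i \<circ> w)"
  using assms(1,5) unfolding bruhat_le_def
proof (induction rule: rtranclp_induct)
  case base
  then show ?case using assms(4) by simp
next
  case (step y z)
  have y: "y \<in> S_inf" using step.hyps(2) by (simp add: bruhat_step_def)
  consider "adj i \<circ> y = z" | "bruhat_step (adj i \<circ> y) (adj i \<circ> z)"
    using bruhat_step_lift[OF step.hyps(2) assms(3)] by blast
  then show ?case
  proof cases
    case 1
    then have "adj i \<circ> z = y" by (metis adj_adj_comp)
    then show ?thesis using step.hyps(1) by (simp only:)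
  next
    case 2
    show ?thesis
    proof (cases "left_descent i y")
      case True
      then show ?thesis using step.IH 2 by (meson rtranclp.rtrancl_into_rtrancl)
    next
      case False
      then show ?thesis
        using bruhat_step_adj_comp[OF y assms(3)] step.hyps(1) 2
        by (meson rtranclp.rtrancl_into_rtrancl)
    qed
  qed
qed

definition bruhat_interval :: "(nat \<Rightarrow> nat) \<Rightarrow> (nat \<Rightarrow> nat) set" where
  "bruhat_interval w = {v \<in> S_inf. bruhat_le v w}"

text \<open>
  An element below \<open>s\<^sub>i x\<close> without descent \<open>i\<close> is already below \<open>x\<close>; one with
  descent \<open>i\<close> becomes such an element when multiplied by \<open>s\<^sub>i\<close>. Conversely, lifting \<open>v \<le> x\<close>
  keeps \<open>s\<^sub>i v\<close> below \<open>x\<close> or \<open>s\<^sub>i x\<close>.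
\<close>

lemma bruhat_interval_adj_comp:
  assumes "x \<in> S_inf" "1 \<le> i" "\<not> left_descent i x"
  defines "U \<equiv> {v \<in> bruhat_interval x. \<not> left_descent i v}"
  shows "bruhat_interval (adj i \<circ> x) = U \<union> (\<circ>) (adj i) ` U"
proof (intro equalityI subsetI)
  fix v assume "v \<in> bruhat_interval (adj i \<circ> x)"
  then have v: "v \<in> S_inf" "bruhat_le v (adj i \<circ> x)" by (simp_all add: bruhat_interval_def)
  have desc: "left_descent i (adj i \<circ> x)"
    using assms(3) left_descent_adj_comp[OF S_inf_bij[OF assms(1)]] by blast
  note below = bruhat_le_adj_comp_of_descent[OF _ _ assms(2) _ desc, unfolded adj_adj_comp]
  show "v \<in> U \<union> (\<circ>) (adj i) ` U"
  proof (cases "left_descent i v")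
    case False
    then show ?thesis using below[OF v(2,1)] v(1) by (simp add: U_def bruhat_interval_def)
  next
    case True
    let ?u = "adj i \<circ> v"
    have u: "?u \<in> S_inf" by (intro S_inf_comp adj_in_S_inf assms(2) v(1))
    have asc: "\<not> left_descent i ?u"
      using True left_descent_adj_comp[OF S_inf_bij[OF v(1)]] by blast
    have "bruhat_le ?u v"
      using bruhat_step_le[OF bruhat_step_adj_comp[OF u assms(2) asc]] by (simp only: adj_adj_comp)
    then have "bruhat_le ?u x" using below[OF bruhat_le_trans[OF _ v(2)] u asc] by blast
    then have "?u \<in> U" using u asc unfolding U_def bruhat_interval_def by blast
    moreover have "v = adj i \<circ> ?u" by (simp only: adj_adj_comp)
    ultimately show ?thesis by blast
  qed
next
  fix v assume "v \<in> U \<union> (\<circ>) (adj i) ` U"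
  then obtain u where u: "u \<in> S_inf" "bruhat_le u x" "v = u \<or> v = adj i \<circ> u"
    by (auto simp only: U_def bruhat_interval_def)
  have up: "bruhat_le x (adj i \<circ> x)"
    using bruhat_step_le[OF bruhat_step_adj_comp[OF assms(1-3)]] .
  have "bruhat_le v (adj i \<circ> x)"
    using u(2,3) up bruhat_le_lift[OF u(2) assms(2)] bruhat_le_trans by blast
  moreover have "v \<in> S_inf"
    using u(1,3) S_inf_comp[OF adj_in_S_inf[OF assms(2)]] by blast
  ultimately show "v \<in> bruhat_interval (adj i \<circ> x)" by (simp add: bruhat_interval_def)
qed

lemma bruhat_interval_id: "bruhat_interval id = {id}"
proof -
  have len: "len id = 0" using len_le_length[of "[]"] by simp
  have "v = id" if "bruhat_step\<^sup>*\<^sup>* v id" for v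
    using that by (cases rule: rtranclp.cases) (auto simp: bruhat_step_def len)
  moreover have "id \<in> S_inf" unfolding S_inf_def by (rule CollectI, rule exI[of _ "[]"]) simp
  ultimately show ?thesis by (auto simp: bruhat_interval_def bruhat_le_def)
qed

section \<open>Expansion of the operators\<close>

lemma pi_bar_perm_reduced_word:
  assumes "reduced_word a w"
  shows "pi_bar_perm w f = foldr pi_bar_op a f"
  unfolding pi_bar_perm_def
  by (rule foldr_reduced_word_unique[where ops = pi_bar_op, OF pi_bar_op_commute pi_bar_op_braid _ assms])
    (assumption, rule reduced_word_some[OF reduced_word_in_S_inf[OF assms]])

lemma pi_bar_perm_adj_comp:
  assumes "w \<in> S_inf" "1 \<le> i" "\<not> left_descent i w"
  shows "pi_bar_perm (adj i \<circ> w) f = pi_bar_op i (pi_bar_perm w f)"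
proof -
  obtain a where a: "reduced_word a w" using reduced_word_exists assms(1) by blast
  have "left_descent i (adj i \<circ> w)"
    using assms(3) left_descent_adj_comp[OF S_inf_bij[OF assms(1)]] by blast
  then have "reduced_word (i # a) (adj i \<circ> w)"
    using a assms(2) unfolding reduced_word_Cons_iff adj_adj_comp by blast
  then show ?thesis using a by (simp add: pi_bar_perm_reduced_word)
qed

text \<open>
  Here \<open>w\<close> has a reduced word starting with \<open>i\<close>, and \<open>\<pi>\<^sub>i \<pi>'\<^sub>i = (1 + \<pi>'\<^sub>i) \<pi>'\<^sub>i = 0\<close>.
\<close>

lemma pi_op_pi_bar_perm_descent:
  assumes "w \<in> S_inf" "1 \<le> i" "left_descent i w"
  shows "pi_op i (pi_bar_perm w f) = 0"
proof -
  let ?u = "adj i \<circ> w"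
  have "?u \<in> S_inf" by (intro S_inf_comp adj_in_S_inf assms(1,2))
  moreover have "\<not> left_descent i ?u"
    using assms(3) left_descent_adj_comp[OF S_inf_bij[OF assms(1)]] by blast
  ultimately have "pi_bar_perm w f = pi_bar_op i (pi_bar_perm ?u f)"
    using pi_bar_perm_adj_comp[of ?u i f] assms(2) unfolding adj_adj_comp by blast
  then have "pi_bar_op i (pi_bar_perm w f) = - pi_bar_perm w f"
    by (simp add: pi_bar_op_idem)
  then show ?thesis by (simp add: pi_bar_op_def)
qed

text \<open>
  Finiteness of the interval is carried along in the induction because the sum over an infinite
  set is zero by convention.
\<close>

lemma foldr_pi_op_expansion:
  assumes "reduced_word a w"
  shows "finite (bruhat_interval w)
    \<and> foldr pi_op a f = (\<Sum>v\<in>bruhat_interval w. pi_bar_perm v f)"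
  using assms
proof (induction a arbitrary: w)
  case Nil
  then have w: "w = id" by (simp add: reduced_word_def)
  have "pi_bar_perm w f = f" using pi_bar_perm_reduced_word[OF Nil] by simp
  moreover have "bruhat_interval w = {w}" unfolding w by (rule bruhat_interval_id)
  ultimately show ?case by simp
next
  case (Cons i a)
  define x where "x = adj i \<circ> w"
  have w: "w = adj i \<circ> x" by (simp only: x_def adj_adj_comp)
  have i: "1 \<le> i" and desc: "left_descent i w" and a: "reduced_word a x"
    using Cons.prems unfolding reduced_word_Cons_iff x_def by blast+
  have S: "x \<in> S_inf" by (rule reduced_word_in_S_inf[OF a])
  have asc: "\<not> left_descent i x"
    using desc left_descent_adj_comp[OF S_inf_bij[OF S]] w by blast
  let ?B = "bruhat_interval x"
  define U where "U = {v \<in> ?B. \<not> left_descent i v}"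
  have B: "bruhat_interval w = U \<union> (\<circ>) (adj i) ` U"
    unfolding w U_def by (rule bruhat_interval_adj_comp[OF S i asc])
  have fin: "finite ?B" and IH: "foldr pi_op a f = (\<Sum>v\<in>?B. pi_bar_perm v f)"
    using Cons.IH[OF a] by blast+
  have finU: "finite U" using fin by (simp add: U_def)
  have U: "v \<in> S_inf" "\<not> left_descent i v" if "v \<in> U" for v
    using that by (auto simp only: U_def bruhat_interval_def)
  have disj: "U \<inter> (\<circ>) (adj i) ` U = {}"
    using U left_descent_adj_comp[OF S_inf_bij] by blast
  have inj: "inj_on ((\<circ>) (adj i)) U"
    by (rule inj_onI) (metis adj_adj_comp)
  have "foldr pi_op (i # a) f = pi_op i (\<Sum>v\<in>?B. pi_bar_perm v f)"
    using IH by simp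
  also have "\<dots> = (\<Sum>v\<in>?B. pi_op i (pi_bar_perm v f))"
    using pi_bar_op_sum[of i "\<lambda>v. pi_bar_perm v f" ?B]
    by (simp add: pi_bar_op_def sum_subtractf)
  \<comment> \<open>The elements with descent \<open>i\<close> contribute nothing.\<close>
  also have "\<dots> = (\<Sum>v\<in>U. pi_op i (pi_bar_perm v f))"
    using pi_op_pi_bar_perm_descent[OF _ i] fin
    by (intro sum.mono_neutral_right) (auto simp only: U_def bruhat_interval_def)
  also have "\<dots> = (\<Sum>v\<in>U. pi_bar_perm v f + pi_bar_perm (adj i \<circ> v) f)"
    by (intro sum.cong refl) (simp add: pi_bar_perm_adj_comp[OF U(1) i U(2)] pi_bar_op_def)
  also have "\<dots> = (\<Sum>v\<in>U. pi_bar_perm v f) + (\<Sum>v\<in>(\<circ>) (adj i) ` U. pi_bar_perm v f)"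
    by (simp add: sum.distrib sum.reindex[OF inj])
  also have "\<dots> = (\<Sum>v\<in>bruhat_interval w. pi_bar_perm v f)"
    unfolding B using finU disj by (intro sum.union_disjoint[symmetric]) auto
  finally show ?case using finU B by simp
qed

lemma pi_perm_expansion:
  assumes "w \<in> S_inf"
  shows "pi_perm w f = (\<Sum>v\<in>{v \<in> S_inf. bruhat_le v w}. pi_bar_perm v f)"
  using foldr_pi_op_expansion[OF reduced_word_some[OF assms]]
  by (simp add: pi_perm_def bruhat_interval_def)

theorem proposition2p7:
  fixes w \<mu> :: "nat \<Rightarrow> nat"
  assumes "w \<in> S_inf" and "strict_partition \<mu>"
  shows "kappa_P w \<mu> = (\<Sum>v\<in>{v \<in> S_inf. bruhat_le v w}. kappa_bar_P v \<mu>) \<and>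
         kappa_Q w \<mu> = (\<Sum>v\<in>{v \<in> S_inf. bruhat_le v w}. kappa_bar_Q v \<mu>)"
  unfolding kappa_P_def kappa_Q_def kappa_bar_P_def kappa_bar_Q_def
  using pi_perm_expansion[OF assms(1)] by blast

end
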